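(* Let $G=(V,E,w)$ be a finite connected weighted graph with graph Laplacian $L$ and eigenvalues $\lambda_1\le\cdots\le\lambda_{|V|}$. Let $\psi$ be any eigenvector of $L$ for the eigenvalue $\lambda_k$ that is non-zero at every vertex, where $k=\min\{m:L\psi=\lambda_m\psi\}$. Then $\nu(\psi)\le k$.
   Context: $G=(V,E,w)$ is a finite connected weighted undirected graph without self-loops or multiple edges, with weights $w_{ij}=w_{ji}>0$ on edges and $w_{ij}=0$ for non-edges. Its graph Laplacian is $L=D-W$ with $W=(w_{ij})$ and $D$ the diagonal matrix with entries $\sum_j w_{ij}$. Its eigenvalues are listed with multiplicity as $0=\lambda_1\le\lambda_2\le\cdots\le\lambda_{|V|}$. Let $E_\pm=\{(i,j)\in E:\psi_i\psi_j<0\}$. The nodal domains of $\psi$ are the connected components of $(V,E\setminus E_\pm)$, and $\nu(\psi)$ is their number. *)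

theory Defs
  imports "HOL-Analysis.Analysis" "HOL-Computational_Algebra.Polynomial" "HOL-Library.Multiset"
begin

text \<open>
  The vertex set is the finite type \<open>'v\<close>. An undirected edge \<open>{i, j}\<close> is represented by the two
  ordered pairs \<open>(i, j)\<close> and \<open>(j, i)\<close>.
\<close>

definition weighted_graph :: "('v::finite \<times> 'v) set \<Rightarrow> real^'v^'v \<Rightarrow> bool" where
  "weighted_graph E W \<longleftrightarrow> sym E \<and> irrefl E \<and>
     (\<forall>i j. W $ i $ j = W $ j $ i) \<and>
     (\<forall>i j. (i, j) \<in> E \<longrightarrow> W $ i $ j > 0) \<and>
     (\<forall>i j. (i, j) \<notin> E \<longrightarrow> W $ i $ j = 0)"

definition connected_graph :: "('v::finite \<times> 'v) set \<Rightarrow> bool" where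
  "connected_graph E \<longleftrightarrow> (\<forall>i j. (i, j) \<in> E\<^sup>*)"

definition degree_matrix :: "real^'v^'v \<Rightarrow> real^'v^('v::finite)" where
  "degree_matrix W = (\<chi> i j. if i = j then (\<Sum>l\<in>UNIV. W $ i $ l) else 0)"

definition laplacian :: "real^'v^'v \<Rightarrow> real^'v^('v::finite)" where
  "laplacian W = degree_matrix W - W"

definition charpoly :: "real^'n^'n \<Rightarrow> real poly" where
  "charpoly A = det (mat [:0, 1:] - (\<chi> i j. [:A $ i $ j:]))"

text \<open>
  \<open>eigval A m\<close> is the \<open>m\<close>-th smallest real eigenvalue, counted with multiplicity, with indices
  starting at \<open>1\<close>. The matrices \<open>A\<close> of interest are symmetric, so all \<open>CARD('n)\<close> roots of the
  characteristic polynomial are real and the list has length \<open>CARD('n)\<close>.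
\<close>

definition eigval :: "real^'n^'n \<Rightarrow> nat \<Rightarrow> real" where
  "eigval A m = sorted_list_of_multiset (proots (charpoly A)) ! (m - 1)"

definition is_eigenvector :: "real^'n^'n \<Rightarrow> real^'n \<Rightarrow> real \<Rightarrow> bool" where
  "is_eigenvector A v a \<longleftrightarrow> v \<noteq> 0 \<and> A *v v = a *\<^sub>R v"

definition sign_change_edges :: "('v::finite \<times> 'v) set \<Rightarrow> real^'v \<Rightarrow> ('v \<times> 'v) set" where
  "sign_change_edges E \<psi> = {(i, j) \<in> E. \<psi> $ i * \<psi> $ j < 0}"

text \<open>
  For a symmetric relation \<open>F\<close>, reachability \<open>F\<^sup>*\<close> is an equivalence relation on the vertices,
  whose classes are the vertex sets of the connected components.
\<close>

definition nodal_domains :: "('v::finite \<times> 'v) set \<Rightarrow> real^'v \<Rightarrow> 'v set set" where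
  "nodal_domains E \<psi> = UNIV // (E - sign_change_edges E \<psi>)\<^sup>*"

definition nodal_count :: "('v::finite \<times> 'v) set \<Rightarrow> real^'v \<Rightarrow> nat" where
  "nodal_count E \<psi> = card (nodal_domains E \<psi>)"

lemma poly_charpoly: "poly (charpoly A) x = det (mat x - A)"
proof -
  have "poly (of_int i) x = of_int i" for i
    by (simp add: of_int_poly)
  then show ?thesis
    by (auto simp: charpoly_def det_def poly_sum poly_prod mat_def if_distrib
             intro!: sum.cong prod.cong)
qed

end

theory Submission
  imports Defs
begin

text \<open>
  The proof is the classical argument of Courant, in the form that it takes on a graph. Let
  \<open>\<lambda> = \<lambda>\<^sub>k\<close>, and consider the vectors \<open>f\<close> with entries \<open>a\<^sub>i \<psi>\<^sub>i\<close>, where \<open>a\<close> is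
  constant on every nodal domain of \<open>\<psi>\<close>. They form a space of dimension \<open>\<nu>(\<psi>)\<close>, as \<open>\<psi>\<close> vanishes
  nowhere. The eigenvalue equation turns the quadratic form of \<open>L - \<lambda>\<close> on this space into
  \<open>f \<bullet> L f - \<lambda> (f \<bullet> f) = (1/2) \<Sum>\<^sub>i\<^sub>j w\<^sub>i\<^sub>j \<psi>\<^sub>i \<psi>\<^sub>j (a\<^sub>i - a\<^sub>j)\<^sup>2\<close>,
  which is \<open>quadratic_form_of_multiple\<close>. Only edges between different domains contribute, and there
  \<open>\<psi>\<^sub>i \<psi>\<^sub>j < 0\<close>: the form is nonpositive.

  On the other hand, at most \<open>k - 1\<close> members of an orthonormal eigenbasis of \<open>L\<close> have an eigenvalue
  below \<open>\<lambda>\<close> (\<open>card_eigenvalues_below_eigval\<close>), and on vectors orthogonal to these the form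
  is nonnegative (\<open>rayleigh_lower_bound\<close>). If \<open>\<nu>(\<psi>) > k\<close>, there is room for one more linear
  condition: some \<open>f \<noteq> 0\<close> as above is orthogonal to the low eigenvectors and vanishes at a chosen
  vertex. Its form is both nonnegative and nonpositive, so every summand is zero, and \<open>a\<close> takes equal
  values at the ends of every edge. By connectedness \<open>a\<close> is constant, and it is zero at the chosen
  vertex, so \<open>f = 0\<close>, a contradiction. Without the extra condition \<open>f = \<psi>\<close> would satisfy
  all requirements.

  Since \<open>\<lambda>\<^sub>k\<close> is defined through the roots of the characteristic polynomial, the orthonormal
  eigenbasis has two uses: it diagonalises the quadratic form, and it factors the characteristic
  polynomial, which identifies these roots with the eigenvalues of the basis vectors.
\<close>

section \<open>Orthonormal eigenbases\<close>

text \<open>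
  A maximiser \<open>v\<close> of the quadratic form \<open>x \<bullet> f x\<close> on the unit sphere of \<open>S\<close> is an eigenvector,
  and its eigenvalue is the maximum \<open>c\<close>: moving from \<open>v\<close> in the direction of the residual
  \<open>r = c v - f v\<close> must not violate \<open>x \<bullet> f x \<le> c (x \<bullet> x)\<close>, and the first-order
  term of this inequality is a multiple of \<open>r \<bullet> r\<close>.
\<close>

lemma self_adjoint_eigenvector_exists:
  fixes f :: "'a::euclidean_space \<Rightarrow> 'a"
  assumes "linear f" and adj: "\<And>x y. f x \<bullet> y = x \<bullet> f y"
    and S: "subspace S" "f ` S \<subseteq> S" "S \<noteq> {0}"
  obtains v c where "v \<in> S" "norm v = 1" "f v = c *\<^sub>R v"
proof -
  interpret linear f by fact
  obtain u where u: "u \<in> S" "u \<noteq> 0"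
    using S subspace_0 by blast
  have "u /\<^sub>R norm u \<in> S \<inter> sphere 0 1"
    using u S(1) by (simp add: subspace_scale)
  moreover have "compact (S \<inter> sphere 0 1)"
    by (simp add: S(1) closed_Int_compact closed_subspace)
  moreover have "continuous_on (S \<inter> sphere 0 1) (\<lambda>x. x \<bullet> f x)"
    using \<open>linear f\<close> by (intro continuous_intros linear_continuous_on)
       (simp add: linear_conv_bounded_linear)
  ultimately obtain v where v: "v \<in> S" "norm v = 1"
    and vmax: "\<And>x. x \<in> S \<Longrightarrow> norm x = 1 \<Longrightarrow> x \<bullet> f x \<le> v \<bullet> f v"
    using continuous_attains_sup[of "S \<inter> sphere 0 1" "\<lambda>x. x \<bullet> f x"]
    by (metis IntI Int_iff empty_iff mem_sphere_0)
  define c where "c = v \<bullet> f v"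
  have bound: "x \<bullet> f x \<le> c * (x \<bullet> x)" if "x \<in> S" for x
  proof (cases "x = 0")
    case False
    have "(x /\<^sub>R norm x) \<bullet> f (x /\<^sub>R norm x) \<le> c"
      unfolding c_def using that False S(1) by (intro vmax) (auto simp: subspace_scale)
    then show ?thesis
      using False by (simp add: scale field_simps power2_norm_eq_inner[symmetric] power2_eq_square)
  qed simp
  define r where "r = c *\<^sub>R v - f v"
  define q where "q = c * (r \<bullet> r) - r \<bullet> f r"
  have rS: "r \<in> S"
    unfolding r_def using v S by (intro subspace_diff subspace_scale) auto
  have q0: "q \<ge> 0"
    using bound[OF rS] by (simp add: q_def)
  have vv: "v \<bullet> v = 1"
    using v by (simp add: norm_eq_1)
  have quad: "0 \<le> 2 * t * (r \<bullet> r) + t\<^sup>2 * q" for t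
  proof -
    have "v + t *\<^sub>R r \<in> S"
      using v rS S(1) by (simp add: subspace_add subspace_scale)
    from bound[OF this] have "(v + t *\<^sub>R r) \<bullet> f (v + t *\<^sub>R r)
        \<le> c * ((v + t *\<^sub>R r) \<bullet> (v + t *\<^sub>R r))" .
    also have "(v + t *\<^sub>R r) \<bullet> f (v + t *\<^sub>R r)
        = c + 2 * t * (r \<bullet> f v) + t\<^sup>2 * (r \<bullet> f r)"
      using adj[of v r] by (simp add: add scale inner_simps c_def power2_eq_square inner_commute)
    also have "(v + t *\<^sub>R r) \<bullet> (v + t *\<^sub>R r) = 1 + 2 * t * (r \<bullet> v) + t\<^sup>2 * (r \<bullet> r)"
      by (simp add: inner_simps vv power2_eq_square inner_commute)
    finally have "0 \<le> 2 * t * (c * (r \<bullet> v) - r \<bullet> f v) + t\<^sup>2 * q"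
      by (simp add: q_def algebra_simps)
    moreover have "r \<bullet> r = c * (r \<bullet> v) - r \<bullet> f v"
      unfolding r_def by (simp add: inner_diff_right)
    ultimately show ?thesis
      by simp
  qed
  have "r \<bullet> r = 0"
  proof (rule ccontr)
    assume "r \<bullet> r \<noteq> 0"
    then have pos: "r \<bullet> r > 0" by simp
    \<comment> \<open>Any negative \<open>t\<close> close enough to \<open>0\<close> makes the linear term dominate; adding \<open>1\<close>
      to \<open>q\<close> also covers \<open>q = 0\<close>.\<close>
    define t where "t = - (r \<bullet> r) / (q + 1)"
    have "t < 0" "(q + 1) * t = - (r \<bullet> r)"
      using pos q0 by (simp_all add: t_def field_simps)
    then have "q * t = - (r \<bullet> r) - t"
      by (simp add: algebra_simps)
    moreover have "2 * t * (r \<bullet> r) + t\<^sup>2 * q = t * (2 * (r \<bullet> r) + q * t)"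
      by (simp add: algebra_simps power2_eq_square)
    ultimately have "2 * t * (r \<bullet> r) + t\<^sup>2 * q = t * (r \<bullet> r - t)"
      by simp
    moreover have "t * (r \<bullet> r - t) < 0"
      using \<open>t < 0\<close> pos by (intro mult_neg_pos; linarith)
    ultimately show False
      using quad[of t] by simp
  qed
  then have "f v = c *\<^sub>R v"
    by (simp add: r_def)
  with v show ?thesis
    using that by blast
qed

text \<open>
  Split off one unit eigenvector \<open>v\<close>; self-adjointness keeps the orthogonal complement of \<open>v\<close> in \<open>S\<close>
  invariant, and its dimension is smaller.
\<close>

lemma self_adjoint_orthonormal_eigenbasis:
  fixes f :: "'a::euclidean_space \<Rightarrow> 'a"
  assumes lin: "linear f" and adj: "\<And>x y. f x \<bullet> y = x \<bullet> f y"
    and "subspace S" "f ` S \<subseteq> S"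
  shows "\<exists>B. B \<subseteq> S \<and> pairwise orthogonal B \<and> (\<forall>b\<in>B. norm b = 1 \<and> (\<exists>c. f b = c *\<^sub>R b))
           \<and> span B = S"
  using assms(3,4)
proof (induction "dim S" arbitrary: S rule: less_induct)
  case less
  show ?case
  proof (cases "S = {0}")
    case True
    then show ?thesis
      by (intro exI[of _ "{}"]) auto
  next
    case False
    obtain v c where v: "v \<in> S" "norm v = 1" "f v = c *\<^sub>R v"
      using self_adjoint_eigenvector_exists[OF lin adj less.prems False] by blast
    define S' where "S' = {x \<in> S. v \<bullet> x = 0}"
    have sub': "subspace S'"
      using less.prems(1) unfolding S'_def subspace_def by (auto simp: inner_simps)
    have inv': "f ` S' \<subseteq> S'"
    proof
      fix y assume "y \<in> f ` S'"
      then obtain x where "y = f x" "x \<in> S" "v \<bullet> x = 0"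
        by (auto simp: S'_def)
      then show "y \<in> S'"
        using less.prems(2) adj[of v x] by (auto simp: S'_def v)
    qed
    have "v \<notin> S'"
      using v by (auto simp: S'_def)
    moreover have "S' \<subseteq> S"
      by (auto simp: S'_def)
    ultimately have "S' \<subset> S"
      using v(1) by blast
    then have "dim S' < dim S"
      using sub' less.prems(1) by (metis dim_psubset span_eq_iff)
    from less.hyps[OF this sub' inv'] obtain B where B: "B \<subseteq> S'" "pairwise orthogonal B"
      "\<forall>b\<in>B. norm b = 1 \<and> (\<exists>c. f b = c *\<^sub>R b)" "span B = S'"
      by blast
    have "pairwise orthogonal (insert v B)"
      using B(1,2) by (auto simp: pairwise_insert S'_def orthogonal_def inner_commute)
    moreover have "span (insert v B) = S"
    proof
      show "span (insert v B) \<subseteq> S"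
        using B(1) v less.prems(1) by (intro span_minimal) (auto simp: S'_def)
      show "S \<subseteq> span (insert v B)"
      proof
        fix x assume "x \<in> S"
        then have "x - (v \<bullet> x) *\<^sub>R v \<in> S'"
          using v less.prems(1)
          by (auto simp: S'_def subspace_diff subspace_scale inner_simps norm_eq_1)
        then show "x \<in> span (insert v B)"
          using B(4) by (metis span_breakdown_eq)
      qed
    qed
    ultimately show ?thesis
      using B v by (intro exI[of _ "insert v B"]) (auto simp: S'_def)
  qed
qed

text \<open>
  The basis is indexed by the index type of the matrix, so that eigenvalues are counted with their
  multiplicity and the basis vectors can be the columns of a square matrix.
\<close>

lemma symmetric_matrix_orthonormal_eigenbasis:
  fixes A :: "real^'n^'n"
  assumes "transpose A = A"
  obtains p :: "'n \<Rightarrow> real^'n" and \<mu> :: "'n \<Rightarrow> real"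
  where "\<And>i j. p i \<bullet> p j = (if i = j then 1 else 0)"
    and "\<And>j. A *v p j = \<mu> j *\<^sub>R p j"
    and "\<And>x. (\<Sum>j\<in>UNIV. (x \<bullet> p j) *\<^sub>R p j) = x"
proof -
  have "(A *v x) \<bullet> y = x \<bullet> (A *v y)" for x y
    by (metis assms dot_lmul_matrix transpose_matrix_vector)
  then obtain B where B: "pairwise orthogonal B" "span B = UNIV"
      "\<And>b. b \<in> B \<Longrightarrow> norm b = 1" "\<And>b. b \<in> B \<Longrightarrow> \<exists>c. A *v b = c *\<^sub>R b"
    using self_adjoint_orthonormal_eigenbasis[of "(*v) A" UNIV] by auto
  have "0 \<notin> B"
    using B(3) by fastforce
  with B(1) have ind: "independent B"
    by (rule pairwise_orthogonal_independent)
  have fin: "finite B"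
    using ind by (rule independent_imp_finite)
  have "card B = CARD('n)"
    using dim_eq_card_independent[OF ind] dim_span[of B] B(2) by simp
  then obtain p where p: "bij_betw p (UNIV :: 'n set) B"
    using fin by (metis finite_same_card_bij finite)
  obtain \<nu> where \<nu>: "\<And>b. b \<in> B \<Longrightarrow> A *v b = \<nu> b *\<^sub>R b"
    using B(4) by metis
  have pB: "p j \<in> B" for j
    using p bij_betwE by blast
  show ?thesis
  proof
    fix i j x
    show "p i \<bullet> p j = (if i = j then 1 else 0)"
    proof (cases "i = j")
      case False
      then have "p i \<noteq> p j"
        using p by (auto simp: bij_betw_def inj_on_def)
      then show ?thesis
        using False B(1) pB by (auto simp: pairwise_def orthogonal_def)
    qed (use B(3) pB in \<open>simp add: norm_eq_1[symmetric]\<close>)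
    show "A *v p j = (\<nu> \<circ> p) j *\<^sub>R p j"
      using \<nu> pB by simp
    show "(\<Sum>j\<in>UNIV. (x \<bullet> p j) *\<^sub>R p j) = x"
      using orthonormal_basis_expand[OF B(1,3) _ fin, of x] B(2)
        sum.reindex_bij_betw[OF p, of "\<lambda>b. (x \<bullet> b) *\<^sub>R b"] by simp
  qed
qed

section \<open>Sorted eigenvalues\<close>

text \<open>
  With the basis vectors as the columns of \<open>P\<close> one has \<open>(x - A) P = P D\<close> for the diagonal matrix \<open>D\<close>
  with entries \<open>x - \<mu>\<^sub>j\<close>, and \<open>det P \<noteq> 0\<close> cancels.
\<close>

lemma charpoly_of_orthonormal_eigenbasis:
  fixes A :: "real^'n^'n" and p :: "'n \<Rightarrow> real^'n"
  assumes orth: "\<And>i j. p i \<bullet> p j = (if i = j then 1 else 0)"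
    and eig: "\<And>j. A *v p j = \<mu> j *\<^sub>R p j"
  shows "charpoly A = (\<Prod>j\<in>UNIV. [:- \<mu> j, 1:])"
proof -
  define P :: "real^'n^'n" where "P = (\<chi> i j. p j $ i)"
  have "transpose P ** P = mat 1"
    using orth by (simp add: vec_eq_iff P_def transpose_def matrix_matrix_mult_def mat_def inner_vec_def)
  then have detP: "det P \<noteq> 0"
    by (metis det_I det_mul mult_zero_right zero_neq_one)
  have "det (mat x - A) = (\<Prod>j\<in>UNIV. x - \<mu> j)" for x
  proof -
    define D :: "real^'n^'n" where "D = (\<chi> i j. if i = j then x - \<mu> j else 0)"
    have "(\<Sum>l\<in>UNIV. A $ i $ l * p j $ l) = \<mu> j * p j $ i" for i j
      using arg_cong[OF eig[of j], of "\<lambda>v. v $ i"] by (simp add: matrix_vector_mult_def)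
    then have "A ** P = (\<chi> i j. \<mu> j * p j $ i)"
      by (simp add: vec_eq_iff P_def matrix_matrix_mult_def)
    moreover have "mat x ** P = (\<chi> i j. x * p j $ i)" "P ** D = (\<chi> i j. (x - \<mu> j) * p j $ i)"
      by (simp_all add: vec_eq_iff P_def D_def matrix_matrix_mult_def mat_def
          mult_delta_left mult_delta_right mult.commute)
    moreover have "(mat x - A) ** P = mat x ** P - A ** P"
      by (simp add: vec_eq_iff matrix_matrix_mult_def left_diff_distrib sum_subtractf)
    ultimately have "(mat x - A) ** P = P ** D"
      by (simp add: vec_eq_iff left_diff_distrib)
    then have "det (mat x - A) * det P = det P * det D"
      by (metis det_mul)
    moreover have "det D = (\<Prod>j\<in>UNIV. x - \<mu> j)"
      by (subst det_diagonal) (auto simp: D_def)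
    ultimately show ?thesis
      using detP by simp
  qed
  then have "poly (charpoly A) = poly (\<Prod>j\<in>UNIV. [:- \<mu> j, 1:])"
    by (simp add: fun_eq_iff poly_charpoly poly_prod)
  then show ?thesis
    by (simp add: poly_eq_poly_eq_iff)
qed

text \<open>
  In the sorted list of the \<open>\<mu>\<^sub>j\<close> the entry \<open>eigval A k\<close> has position \<open>k - 1\<close>, counted from
  \<open>0\<close>, so strictly smaller entries can occur only at earlier positions.
\<close>

lemma card_eigenvalues_below_eigval:
  fixes A :: "real^'n^'n" and \<mu> :: "'n \<Rightarrow> real"
  assumes "charpoly A = (\<Prod>j\<in>UNIV. [:- \<mu> j, 1:])" and k: "k \<in> {1..CARD('n)}"
  shows "card {j. \<mu> j < eigval A k} \<le> k - 1"
proof -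
  define xs where "xs = sorted_list_of_multiset (proots (charpoly A))"
  have "proots (charpoly A) = image_mset \<mu> (mset_set UNIV)"
    unfolding assms(1) by (subst proots_prod) (auto simp: sum_unfold_sum_mset)
  then have mxs: "mset xs = image_mset \<mu> (mset_set UNIV)"
    by (simp add: xs_def)
  have "length xs = CARD('n)"
    by (metis mxs size_mset size_image_mset size_mset_set)
  have "sorted xs"
    by (simp add: xs_def)
  have ek: "eigval A k = xs ! (k - 1)"
    by (simp add: eigval_def xs_def)
  have "card {j. \<mu> j < eigval A k} = size (filter_mset (\<lambda>y. y < eigval A k) (mset xs))"
    by (simp add: mxs filter_mset_image_mset filter_mset_mset_set)
  also have "\<dots> = card {i. i < length xs \<and> xs ! i < eigval A k}"
    by (simp add: length_filter_conv_card flip: mset_filter)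
  also have "\<dots> \<le> card {..<k - 1}"
  proof (rule card_mono)
    show "{i. i < length xs \<and> xs ! i < eigval A k} \<subseteq> {..<k - 1}"
    proof
      fix i assume "i \<in> {i. i < length xs \<and> xs ! i < eigval A k}"
      then have "\<not> k - 1 \<le> i"
        using sorted_nth_mono[OF \<open>sorted xs\<close>, of "k - 1" i] by (auto simp: ek)
      then show "i \<in> {..<k - 1}" by simp
    qed
  qed simp
  finally show ?thesis by simp
qed

lemma rayleigh_lower_bound:
  fixes A :: "real^'n^'n" and p :: "'n \<Rightarrow> real^'n"
  assumes eig: "\<And>j. A *v p j = \<mu> j *\<^sub>R p j"
    and expand: "\<And>x. (\<Sum>j\<in>UNIV. (x \<bullet> p j) *\<^sub>R p j) = x"
    and low: "\<And>j. \<mu> j < l \<Longrightarrow> f \<bullet> p j = 0"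
  shows "l * (f \<bullet> f) \<le> f \<bullet> (A *v f)"
proof -
  have ff: "f \<bullet> f = (\<Sum>j\<in>UNIV. (f \<bullet> p j)\<^sup>2)"
    using arg_cong[OF expand[of f], of "\<lambda>x. f \<bullet> x"]
    by (simp add: inner_sum_right power2_eq_square)
  have "A *v f = A *v (\<Sum>j\<in>UNIV. (f \<bullet> p j) *\<^sub>R p j)"
    by (simp add: expand)
  also have "\<dots> = (\<Sum>j\<in>UNIV. (f \<bullet> p j) *\<^sub>R (\<mu> j *\<^sub>R p j))"
    by (simp add: linear_sum linear_scale eig)
  finally have "f \<bullet> (A *v f) = (\<Sum>j\<in>UNIV. \<mu> j * (f \<bullet> p j)\<^sup>2)"
    by (simp add: inner_sum_right power2_eq_square algebra_simps)
  moreover have "l * (f \<bullet> p j)\<^sup>2 \<le> \<mu> j * (f \<bullet> p j)\<^sup>2" for j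
    using low[of j] by (cases "\<mu> j < l") (auto intro: mult_right_mono)
  ultimately show ?thesis
    by (simp add: ff sum_distrib_left sum_mono)
qed

section \<open>Multiples of an eigenvector\<close>

text \<open>
  With \<open>M\<^sub>i\<^sub>j = A\<^sub>i\<^sub>j \<psi>\<^sub>i \<psi>\<^sub>j\<close>, the form \<open>f \<bullet> A f\<close> is the sum of
  \<open>M\<^sub>i\<^sub>j a\<^sub>i a\<^sub>j\<close>, while the eigenvalue equation makes \<open>l (f \<bullet> f)\<close> the sum of \<open>M\<^sub>i\<^sub>j a\<^sub>i\<^sup>2\<close>.
  As \<open>M\<close> is symmetric, the latter equals the sum of \<open>M\<^sub>i\<^sub>j a\<^sub>j\<^sup>2\<close> as well, and the difference
  completes to a square. The diagonal of \<open>A\<close> drops out because \<open>a\<^sub>i - a\<^sub>i = 0\<close>; for a Laplacian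
  only edge weights remain.
\<close>

lemma quadratic_form_of_multiple:
  fixes A :: "real^'n^'n" and \<psi> a :: "real^'n"
  assumes sym: "transpose A = A" and eig: "A *v \<psi> = l *\<^sub>R \<psi>"
  defines "f \<equiv> \<chi> i. a $ i * \<psi> $ i"
  shows "f \<bullet> (A *v f) - l * (f \<bullet> f)
       = - (\<Sum>i\<in>UNIV. \<Sum>j\<in>UNIV. A $ i $ j * (\<psi> $ i * \<psi> $ j) * (a $ i - a $ j)\<^sup>2) / 2"
proof -
  define M where "M i j = A $ i $ j * (\<psi> $ i * \<psi> $ j)" for i j
  have M_sym: "M i j = M j i" for i j
    using arg_cong[OF sym, of "\<lambda>B. B $ i $ j"] by (simp add: M_def transpose_def)
  have fAf: "f \<bullet> (A *v f) = (\<Sum>i\<in>UNIV. \<Sum>j\<in>UNIV. M i j * (a $ i * a $ j))"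
    by (simp add: f_def M_def inner_vec_def matrix_vector_mult_def sum_distrib_left mult_ac)
  have "l * \<psi> $ i = (\<Sum>j\<in>UNIV. A $ i $ j * \<psi> $ j)" for i
    using arg_cong[OF eig, of "\<lambda>v. v $ i"] by (simp add: matrix_vector_mult_def)
  then have "(a $ i)\<^sup>2 * \<psi> $ i * (l * \<psi> $ i) = (\<Sum>j\<in>UNIV. M i j * (a $ i)\<^sup>2)" for i
    by (simp add: M_def sum_distrib_left mult_ac)
  then have lff: "l * (f \<bullet> f) = (\<Sum>i\<in>UNIV. \<Sum>j\<in>UNIV. M i j * (a $ i)\<^sup>2)"
    by (simp add: f_def inner_vec_def sum_distrib_left power2_eq_square mult_ac)
  have swap: "(\<Sum>i\<in>UNIV. \<Sum>j\<in>UNIV. M i j * (a $ j)\<^sup>2)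
      = (\<Sum>i\<in>UNIV. \<Sum>j\<in>UNIV. M i j * (a $ i)\<^sup>2)"
    by (subst sum.swap) (simp add: M_sym)
  have "(\<Sum>i\<in>UNIV. \<Sum>j\<in>UNIV. M i j * (a $ i - a $ j)\<^sup>2)
      = (\<Sum>i\<in>UNIV. \<Sum>j\<in>UNIV. M i j * (a $ i)\<^sup>2) + (\<Sum>i\<in>UNIV. \<Sum>j\<in>UNIV. M i j * (a $ j)\<^sup>2)
        - 2 * (\<Sum>i\<in>UNIV. \<Sum>j\<in>UNIV. M i j * (a $ i * a $ j))"
    by (simp add: power2_diff algebra_simps sum.distrib sum_subtractf sum_distrib_left)
  then show ?thesis
    unfolding M_def[symmetric] fAf lff swap by simp
qed

text \<open>
  The restrictions of \<open>\<psi>\<close> to the connected components of \<open>F\<close> lie in the space on the right, are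
  nonzero, and are pairwise orthogonal because their supports are disjoint. The condition
  \<open>f\<^sub>i \<psi>\<^sub>j = f\<^sub>j \<psi>\<^sub>i\<close> states, without a division, that \<open>f / \<psi>\<close> takes equal values at
  the ends of every edge of \<open>F\<close>.
\<close>

lemma dim_domainwise_multiples:
  fixes F :: "('n::finite \<times> 'n) set" and \<psi> :: "real^'n"
  assumes "sym F" and nz: "\<And>i. \<psi> $ i \<noteq> 0"
  shows "card (UNIV // F\<^sup>*) \<le> dim {f. \<forall>(i, j) \<in> F. f $ i * \<psi> $ j = f $ j * \<psi> $ i}" (is "_ \<le> dim ?T")
proof -
  have eq: "equiv UNIV (F\<^sup>*)"
    using \<open>sym F\<close> by (simp add: equiv_def refl_rtrancl sym_rtrancl trans_rtrancl)
  define w where "w D = (\<chi> i. if i \<in> D then \<psi> $ i else 0)" for D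
  have disj: "C = D \<or> C \<inter> D = {}" if "C \<in> UNIV // F\<^sup>*" "D \<in> UNIV // F\<^sup>*" for C D
    using quotient_disj[OF eq that] .
  have ne: "\<exists>i. i \<in> D" if "D \<in> UNIV // F\<^sup>*" for D
    using in_quotient_imp_non_empty[OF eq that] by blast
  have inj: "inj_on w (UNIV // F\<^sup>*)"
  proof (rule inj_onI)
    fix C D assume "C \<in> UNIV // F\<^sup>*" "D \<in> UNIV // F\<^sup>*" "w C = w D"
    moreover obtain i where "i \<in> C" using ne \<open>C \<in> UNIV // F\<^sup>*\<close> by blast
    moreover have "i \<in> D"
      using arg_cong[OF \<open>w C = w D\<close>, of "\<lambda>v. v $ i"] \<open>i \<in> C\<close> nz[of i]
      by (simp add: w_def split: if_splits)
    ultimately show "C = D"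
      using disj by blast
  qed
  have "pairwise orthogonal (w ` (UNIV // F\<^sup>*))"
  proof (clarsimp simp: pairwise_def)
    fix C D assume CD: "C \<in> UNIV // F\<^sup>*" "D \<in> UNIV // F\<^sup>*" "w C \<noteq> w D"
    then have "C \<inter> D = {}" using disj by blast
    then show "orthogonal (w C) (w D)"
      by (auto simp: orthogonal_def inner_vec_def w_def intro!: sum.neutral)
  qed
  moreover have "0 \<notin> w ` (UNIV // F\<^sup>*)"
  proof
    assume "0 \<in> w ` (UNIV // F\<^sup>*)"
    then obtain D where D: "D \<in> UNIV // F\<^sup>*" "w D = 0" by auto
    then obtain i where "i \<in> D" using ne by blast
    with arg_cong[OF D(2), of "\<lambda>v. v $ i"] nz[of i] show False
      by (simp add: w_def)
  qed
  ultimately have ind: "independent (w ` (UNIV // F\<^sup>*))"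
    by (rule pairwise_orthogonal_independent)
  have "w ` (UNIV // F\<^sup>*) \<subseteq> ?T"
  proof clarify
    fix D i j assume D: "D \<in> UNIV // F\<^sup>*" and "(i, j) \<in> F"
    then have "i \<in> D \<longleftrightarrow> j \<in> D"
      using \<open>sym F\<close> in_quotient_imp_closed[OF eq D] by (meson r_into_rtrancl symD)
    then show "w D $ i * \<psi> $ j = w D $ j * \<psi> $ i"
      by (simp add: w_def)
  qed
  then have "card (w ` (UNIV // F\<^sup>*)) \<le> dim ?T"
    using ind by (rule independent_card_le_dim)
  then show ?thesis
    using card_image[OF inj] by simp
qed

lemma exists_orthogonal_in_subspace:
  fixes T :: "'a::euclidean_space set"
  assumes "subspace T" "finite C" "card C < dim T"
  obtains f where "f \<in> T" "f \<noteq> 0" "\<And>c. c \<in> C \<Longrightarrow> f \<bullet> c = 0"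
proof -
  define N where "N = {y. \<forall>x\<in>span C. orthogonal x y}"
  have N: "subspace N"
    unfolding N_def subspace_def orthogonal_def by (auto simp: inner_simps)
  have "dim N + dim (span C) = DIM('a)"
    using dim_subspace_orthogonal_to_vectors[of "span C" UNIV] by (simp add: N_def)
  moreover have "dim (span C) \<le> card C"
    using assms(2) by (simp add: dim_le_card')
  moreover have "dim {x + y |x y. x \<in> T \<and> y \<in> N} + dim (T \<inter> N) = dim T + dim N"
    by (rule dim_sums_Int[OF assms(1) N])
  moreover have "dim {x + y |x y. x \<in> T \<and> y \<in> N} \<le> DIM('a)"
    by (rule dim_subset_UNIV)
  ultimately have "dim (T \<inter> N) \<noteq> 0"
    using assms(3) by linarith
  then obtain f where "f \<in> T" "f \<in> N" "f \<noteq> 0"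
    by (auto simp: dim_eq_0)
  then show ?thesis
    by (intro that) (auto simp: N_def orthogonal_def inner_commute span_base)
qed

section \<open>The nodal count\<close>

theorem corollary2p2:
  fixes E :: "('v::finite \<times> 'v) set" and W :: "real^'v^'v" and \<psi> :: "real^'v" and k :: nat
  assumes "weighted_graph E W" and "connected_graph E"
    and "k \<in> {1..CARD('v)}"
    and "is_eigenvector (laplacian W) \<psi> (eigval (laplacian W) k)"
    and "\<forall>i. \<psi> $ i \<noteq> 0"
    and "k = Min {m \<in> {1..CARD('v)}. laplacian W *v \<psi> = eigval (laplacian W) m *\<^sub>R \<psi>}"
  shows "nodal_count E \<psi> \<le> k"
proof (rule ccontr)
  assume "\<not> nodal_count E \<psi> \<le> k"
  define A where "A = laplacian W"
  define l where "l = eigval A k"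
  define F where "F = E - sign_change_edges E \<psi>"
  define T where "T = {f. \<forall>(i, j) \<in> F. f $ i * \<psi> $ j = f $ j * \<psi> $ i}"
  have nz: "\<psi> $ i \<noteq> 0" for i
    using assms(5) by blast
  have W: "sym E" "\<And>i j. W $ i $ j = W $ j $ i" "\<And>i j. (i, j) \<in> E \<Longrightarrow> W $ i $ j > 0"
      "\<And>i j. (i, j) \<notin> E \<Longrightarrow> W $ i $ j = 0"
    using assms(1) by (auto simp: weighted_graph_def)
  have A_sym: "transpose A = A"
    using W(2) by (simp add: A_def laplacian_def degree_matrix_def transpose_def vec_eq_iff)
  have A_off: "A $ i $ j = - W $ i $ j" if "i \<noteq> j" for i j
    using that by (simp add: A_def laplacian_def degree_matrix_def)
  have A_eig: "A *v \<psi> = l *\<^sub>R \<psi>"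
    using assms(4) by (simp add: is_eigenvector_def A_def l_def)
  obtain p :: "'v \<Rightarrow> real^'v" and \<mu> where orth: "\<And>i j. p i \<bullet> p j = (if i = j then 1 else 0)"
    and eig: "\<And>j. A *v p j = \<mu> j *\<^sub>R p j"
    and expand: "\<And>x. (\<Sum>j\<in>UNIV. (x \<bullet> p j) *\<^sub>R p j) = x"
    using symmetric_matrix_orthonormal_eigenbasis[OF A_sym] by blast
  \<comment> \<open>Any vertex serves as the one at which \<open>f\<close> is forced to vanish.\<close>
  define i0 :: 'v where "i0 = undefined"
  define C where "C = insert (axis i0 1) (p ` {j. \<mu> j < l})"
  have "card C \<le> Suc (card {j. \<mu> j < l})"
    using card_image_le[of "{j. \<mu> j < l}" p] by (simp add: C_def card_insert_if)
  also have "\<dots> \<le> k"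
    using card_eigenvalues_below_eigval[OF charpoly_of_orthonormal_eigenbasis[OF orth eig] assms(3)]
      assms(3) unfolding l_def by (simp, linarith)
  also have "k < card (UNIV // F\<^sup>*)"
    using \<open>\<not> nodal_count E \<psi> \<le> k\<close> by (simp add: nodal_count_def nodal_domains_def F_def)
  also have "sym F"
    using W(1) by (auto simp: F_def sym_def sign_change_edges_def mult.commute)
  then have "card (UNIV // F\<^sup>*) \<le> dim T"
    unfolding T_def using nz by (rule dim_domainwise_multiples)
  finally have "card C < dim T" .
  moreover have "subspace T"
    unfolding T_def subspace_def by (fastforce simp: distrib_right)
  moreover have "finite C"
    by (simp add: C_def)
  ultimately obtain f where f: "f \<in> T" "f \<noteq> 0" "\<And>c. c \<in> C \<Longrightarrow> f \<bullet> c = 0"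
    using exists_orthogonal_in_subspace by blast
  define a where "a = (\<chi> i. f $ i / \<psi> $ i)"
  have f_eq: "f = (\<chi> i. a $ i * \<psi> $ i)"
    using nz by (simp add: a_def vec_eq_iff)
  have a_const: "a $ i = a $ j" if "(i, j) \<in> F" for i j
    using f(1) that nz by (auto simp: T_def a_def field_simps)
  \<comment> \<open>Edges with a sign change have both \<open>A\<^sub>i\<^sub>j < 0\<close> and \<open>\<psi>\<^sub>i \<psi>\<^sub>j < 0\<close>; everywhere else
    one of the factors is zero.\<close>
  define q where "q i j = A $ i $ j * (\<psi> $ i * \<psi> $ j) * (a $ i - a $ j)\<^sup>2" for i j
  have q_nonneg: "q i j \<ge> 0" for i j
  proof (cases "i = j \<or> (i, j) \<notin> E \<or> (i, j) \<in> F")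
    case True
    then show ?thesis
      using a_const[of i j] W(4)[of i j] A_off[of i j] by (cases "i = j") (auto simp: q_def)
  next
    case False
    then have "\<psi> $ i * \<psi> $ j < 0" "A $ i $ j < 0"
      using W(3)[of i j] by (auto simp: F_def sign_change_edges_def A_off)
    then show ?thesis
      by (simp add: q_def mult_nonpos_nonpos)
  qed
  have "l * (f \<bullet> f) \<le> f \<bullet> (A *v f)"
    using eig expand by (rule rayleigh_lower_bound) (auto simp: f(3) C_def)
  then have "(\<Sum>i\<in>UNIV. \<Sum>j\<in>UNIV. q i j) \<le> 0"
    using quadratic_form_of_multiple[OF A_sym A_eig, of a] by (simp add: q_def f_eq)
  then have "(\<Sum>i\<in>UNIV. \<Sum>j\<in>UNIV. q i j) = 0"
    using q_nonneg by (simp add: antisym sum_nonneg)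
  then have q0: "q i j = 0" for i j
    using q_nonneg by (simp add: sum_nonneg_eq_0_iff sum_nonneg)
  have a_edge: "a $ i = a $ j" if "(i, j) \<in> E" for i j
  proof (cases "i = j")
    case False
    then show ?thesis
      using q0[of i j] W(3)[OF that] nz[of i] nz[of j] by (simp add: q_def A_off)
  qed simp
  have "a $ i = a $ i0" for i
  proof -
    have "(i, i0) \<in> E\<^sup>*"
      using assms(2) by (simp add: connected_graph_def)
    then show ?thesis
      by induction (use a_edge in auto)
  qed
  moreover have "a $ i0 = 0"
    using f(3)[of "axis i0 1"] by (simp add: C_def a_def inner_axis)
  ultimately have "f = 0"
    by (simp add: f_eq vec_eq_iff)
  with f(2) show False by simp
qed

end
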